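(* For every prime power $q$, there exist seven planes of $\mathrm{PG}(5,q)$ in higgledy-piggledy arrangement.
   Context: For $k\in\{0,1,\dots,n-1\}$, a strong $k$-blocking set in $\mathrm{PG}(n,q)$ is a point set meeting every $(n-k)$-dimensional subspace $\kappa$ in a set of points spanning $\kappa$. A set $\mathcal{K}$ of $k$-dimensional subspaces of $\mathrm{PG}(n,q)$ is in higgledy-piggledy arrangement (a higgledy-piggledy set) if the union of the points contained in the elements of $\mathcal{K}$ is a strong $k$-blocking set. *)

theory Defs
  imports "HOL-Analysis.Analysis" "HOL-Number_Theory.Prime_Powers"
begin

text \<open>
  The projective space \<open>PG(n, q)\<close> is modelled on the vector space \<open>'a ^ 'n\<close> with
  \<open>CARD('n) = n + 1\<close> over a finite field \<open>'a\<close> of order \<open>q\<close>. A projective subspace is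
  identified with its underlying linear subspace, so projective dimension \<open>d\<close> means
  linear dimension \<open>d + 1\<close>; \<open>vec.subspace\<close>, \<open>vec.dim\<close> and \<open>vec.span\<close> are linear notions
  over \<open>'a\<close>.
\<close>

definition proj_subspaces :: "nat \<Rightarrow> ('a::field ^ 'n::finite) set set" where
  "proj_subspaces d = {U. vec.subspace U \<and> vec.dim U = d + 1}"

abbreviation proj_points :: "('a::field ^ 'n::finite) set set" where
  "proj_points \<equiv> proj_subspaces 0"

definition points_in :: "('a::field ^ 'n::finite) set \<Rightarrow> ('a ^ 'n) set set" where
  "points_in U = {P \<in> proj_points. P \<subseteq> U}"

definition proj_span :: "('a::field ^ 'n::finite) set set \<Rightarrow> ('a ^ 'n) set" where
  "proj_span B = vec.span (\<Union>B)"

text \<open>In the following, \<open>CARD('n) - 1\<close> is the projective dimension \<open>n\<close> of the ambient space.\<close>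

definition strong_blocking_set :: "nat \<Rightarrow> ('a::field ^ 'n::finite) set set \<Rightarrow> bool" where
  "strong_blocking_set k B \<longleftrightarrow>
     k < CARD('n) - 1 \<and> B \<subseteq> proj_points \<and>
     (\<forall>\<kappa> \<in> proj_subspaces (CARD('n) - 1 - k). proj_span (B \<inter> points_in \<kappa>) = \<kappa>)"

definition higgledy_piggledy :: "nat \<Rightarrow> ('a::field ^ 'n::finite) set set \<Rightarrow> bool" where
  "higgledy_piggledy k K \<longleftrightarrow>
     K \<subseteq> proj_subspaces k \<and> strong_blocking_set k (\<Union>U\<in>K. points_in U)"

end

theory Submission
  imports "HOL-Algebra.Algebraic_Closure_Type" "HOL-Number_Theory.Residues" Defs
begin

text \<open>
  Identify the ambient space with the field of order \<open>q ^ 6\<close> and take planes from the Desarguesian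
  spread, whose elements are \<open>{x. x ^ (q ^ 3) = u * x}\<close> with \<open>u ^ (q ^ 3 + 1) = 1\<close>. A solid
  \<open>\<kappa>\<close> meets every plane; if the intersections with the chosen planes do not span \<open>\<kappa>\<close>, then
  they lie in a plane \<open>W \<subseteq> \<kappa>\<close>, and hence \<open>W\<close> meets all the chosen planes.

  For \<open>q \<ge> 3\<close> choose \<open>u = g ^ i\<close> with \<open>i < 7\<close>, where \<open>g ^ (q\<^sup>2 - q + 1) = 1\<close> and
  \<open>g ^ 3 \<noteq> 1\<close>. If \<open>W\<close> meets the spread element of \<open>u\<close>, then a polynomial depending only on \<open>W\<close>, of degree at
  most 1 in each of \<open>u\<close>, \<open>u ^ q\<close>, \<open>u ^ q\<^sup>2\<close>, with nonzero constant term, vanishes at \<open>u\<close>. Since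
  \<open>u ^ (1 + q\<^sup>2) = u ^ q\<close>, its value is a nonzero constant plus a combination of six geometric
  sequences in \<open>i\<close> with ratios different from 1, and such an expression cannot vanish for seven
  consecutive \<open>i\<close>.

  For \<open>q = 2\<close> any seven of the nine spread elements work: \<open>W\<close> has only seven points, so each lies
  in a chosen plane and each chosen plane meets \<open>W\<close> in one point; the eight points of \<open>\<kappa>\<close>
  outside \<open>W\<close> would then lie on the two remaining planes, at most one on each.
\<close>

section \<open>Counting roots of polynomials and vectors of subspaces\<close>

lemma CARD_field_ge_2: "CARD('a::{field,finite}) \<ge> 2"
  using card_mono[of UNIV "{0, 1 :: 'a}"] by simp

text \<open>Split \<open>p\<close> into linear factors given by a multiset \<open>A\<close>. An
  element of multiplicity at least 2 would let \<open>(X - x) ^ 2\<close> divide \<open>p\<close>,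
  making \<open>x\<close> a root of the derivative too; so \<open>A\<close> is a set.\<close>

lemma card_roots_separable:
  fixes p :: "'k::alg_closed_field poly"
  assumes "p \<noteq> 0" and sep: "\<And>x. poly p x = 0 \<Longrightarrow> poly (pderiv p) x \<noteq> 0"
  shows "card {x. poly p x = 0} = degree p"
proof -
  obtain A where A: "size A = degree p" "p = smult (lead_coeff p) (\<Prod>x\<in>#A. [:-x, 1:])"
    using alg_closed_imp_factorization[OF \<open>p \<noteq> 0\<close>] by blast
  have dvd: "(\<Prod>x\<in>#B. [:-x, 1:]) dvd p" if "B \<subseteq># A" for B
  proof -
    have "(\<Prod>x\<in>#B. [:-x, 1:]) dvd (\<Prod>x\<in>#A. [:-x, 1:])"
      using that by (intro prod_mset_subset_imp_dvd image_mset_subseteq_mono)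
    then show ?thesis
      by (subst A(2)) (rule dvd_smult)
  qed
  have "count A x \<le> 1" for x
  proof (rule ccontr)
    assume "\<not> count A x \<le> 1"
    then have "{#x, x#} \<subseteq># A"
      by (auto simp: subseteq_mset_def)
    from dvd[OF this] obtain r where r: "p = [:-x, 1:] * ([:-x, 1:] * r)"
      unfolding dvd_def by (auto simp: mult.assoc simp del: mult_pCons_left mult_pCons_right)
    have "poly p x = 0" "poly (pderiv p) x = 0"
      unfolding r pderiv_mult by (simp_all del: mult_pCons_left)
    with sep show False by blast
  qed
  moreover have "count A x = 0 \<longleftrightarrow> poly p x \<noteq> 0" for x
  proof -
    have "poly p x = lead_coeff p * (\<Prod>y\<in>#A. x - y)"
      by (subst A(2)) (simp add: poly_prod_mset image_mset.compositionality o_def)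
    with \<open>p \<noteq> 0\<close> show ?thesis
      by (auto simp: count_eq_zero_iff)
  qed
  ultimately have "A = mset_set {x. poly p x = 0}"
    using poly_roots_finite[OF \<open>p \<noteq> 0\<close>]
    by (intro multiset_eqI) (simp add: count_mset_set' le_Suc_eq)
  then have "size A = card {x. poly p x = 0}"
    by (metis size_mset_set)
  with A(1) show ?thesis
    by simp
qed

text \<open>Coefficient functions on \<open>B\<close> correspond bijectively to vectors of the span.
  The scaling is left abstract so that this serves both \<open>'a ^ 'n\<close> and the algebraic
  closure over \<open>'a\<close>.\<close>

lemma card_span_independent:
  fixes scale :: "'a::{field,finite} \<Rightarrow> 'b::ab_group_add \<Rightarrow> 'b"
  assumes "vector_space scale" "finite B" "\<not> module.dependent scale B"
  shows "card (module.span scale B) = CARD('a) ^ card B"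
proof -
  interpret vector_space scale by fact
  let ?f = "\<lambda>u. \<Sum>v\<in>B. scale (u v) v"
  have inj: "inj_on ?f (B \<rightarrow>\<^sub>E UNIV)"
  proof (rule inj_onI)
    fix u u' assume *: "u \<in> B \<rightarrow>\<^sub>E UNIV" "u' \<in> B \<rightarrow>\<^sub>E UNIV" "?f u = ?f u'"
    then have "(\<Sum>v\<in>B. scale (u v - u' v) v) = 0"
      by (simp add: scale_left_diff_distrib sum_subtractf)
    then have "u v - u' v = 0" if "v \<in> B" for v
      using independentD[OF assms(3,2) subset_refl, of "\<lambda>v. u v - u' v"] that by blast
    then show "u = u'"
      using * by (intro PiE_ext) auto
  qed
  have im: "?f ` (B \<rightarrow>\<^sub>E UNIV) = span B"
  proof -
    have "?f u \<in> ?f ` (B \<rightarrow>\<^sub>E UNIV)" for u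
      by (rule image_eqI[of _ _ "restrict u B"]) auto
    then show ?thesis
      unfolding span_finite[OF assms(2)] by blast
  qed
  have "card (span B) = card (B \<rightarrow>\<^sub>E (UNIV :: 'a set))"
    using card_image[OF inj] unfolding im .
  also have "\<dots> = CARD('a) ^ card B"
    using assms(2) by (rule card_funcsetE)
  finally show ?thesis .
qed

lemma card_subspace:
  fixes U :: "('a::{field,finite} ^ 'n::finite) set"
  assumes "vec.subspace U"
  shows "card U = CARD('a) ^ vec.dim U"
proof -
  obtain B where "B \<subseteq> U" "vec.independent B" "U \<subseteq> vec.span B" "card B = vec.dim U"
    using vec.basis_exists by blast
  then show ?thesis
    using card_span_independent[OF vec.vector_space_axioms, of B] assms
    by (metis finite_code vec.span_subspace)
qed

section \<open>Frobenius powers and linearized polynomials\<close>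

lemma CARD_field_eq_CHAR_power:
  assumes "primepow CARD('a::{field,finite})"
  shows "\<exists>k. CARD('a) = CHAR('a) ^ k"
proof -
  obtain p k where "prime p" "CARD('a) = p ^ k"
    using assms by (auto simp: primepow_def)
  moreover have "prime CHAR('a)"
    by (simp add: finite_imp_CHAR_pos prime_CHAR_semidom)
  ultimately show ?thesis
    using CHAR_dvd_CARD[where ?'a='a] by (metis prime_dvd_power primes_dvd_imp_eq)
qed

lemma Frobenius_add:
  fixes x y :: "'a::{field,finite} alg_closure"
  assumes "primepow CARD('a)"
  shows "(x + y) ^ (CARD('a) ^ n) = x ^ (CARD('a) ^ n) + y ^ (CARD('a) ^ n)"
proof -
  obtain k where k: "CARD('a) = CHAR('a) ^ k"
    using CARD_field_eq_CHAR_power[OF assms] by blast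
  have "prime CHAR('a alg_closure)"
    by (simp add: finite_imp_CHAR_pos prime_CHAR_semidom)
  then show ?thesis
    by (rule freshmans_dream'[where n="k * n"]) (simp add: k power_mult)
qed

lemma of_nat_CARD_alg_closure: "of_nat CARD('a::{field,finite}) = (0 :: 'a alg_closure)"
  using CHAR_dvd_CARD[where ?'a='a] by (simp add: of_nat_eq_0_iff_char_dvd)

lemma power_CARD_eq: "x ^ CARD('a) = x" for x :: "'a::{field,finite}"
proof (cases "x = 0")
  case False
  \<comment> \<open>Multiplication by \<open>x\<close> permutes the nonzero elements, so their
    product is unchanged by the factor \<open>x ^ (q - 1)\<close>.\<close>
  have "(\<Prod>y\<in>UNIV-{0}. y) = (\<Prod>y\<in>UNIV-{0}. x * y)"
    by (rule prod.reindex_bij_witness[of _ "\<lambda>y. x * y" "\<lambda>y. y / x"]) (use False in auto)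
  also have "\<dots> = x ^ (CARD('a) - 1) * (\<Prod>y\<in>UNIV-{0}. y)"
    by (simp add: prod.distrib)
  finally have "x ^ (CARD('a) - 1) = 1"
    by simp
  then show ?thesis
    by (metis finite_UNIV_card_ge_0 finite_code mult.right_neutral power_eq_if less_not_refl)
qed simp

text \<open>The base field supplies \<open>q\<close> roots of \<open>X ^ q - X\<close>, and this
  polynomial has no more than \<open>q\<close>.\<close>

lemma range_to_ac_eq: "range (to_ac :: 'a::{field,finite} \<Rightarrow> _) = {x. x ^ CARD('a) = x}"
proof (rule card_seteq)
  let ?p = "monom 1 CARD('a) - [:0, 1:] :: 'a alg_closure poly"
  have *: "{x. x ^ CARD('a) = x} = {x. poly ?p x = 0}"
    by (simp add: poly_monom)
  have "CARD('a) > 1"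
    using CARD_field_ge_2[where ?'a='a] by simp
  then have deg: "degree ?p = CARD('a)"
    by (simp add: degree_add_eq_left degree_monom_eq diff_conv_add_uminus del: add_uminus_conv_diff)
  with \<open>CARD('a) > 1\<close> have "?p \<noteq> 0" by force
  then show "finite {x :: 'a alg_closure. x ^ CARD('a) = x}"
    unfolding * by (rule poly_roots_finite)
  show "card {x :: 'a alg_closure. x ^ CARD('a) = x} \<le> card (range (to_ac :: 'a \<Rightarrow> _))"
    using card_poly_roots_bound[OF \<open>?p \<noteq> 0\<close>] deg
    unfolding * by (simp add: card_image inj_to_ac)
  show "range to_ac \<subseteq> {x :: 'a alg_closure. x ^ CARD('a) = x}"
    by (auto simp: power_CARD_eq simp flip: to_ac_power)
qed

interpretation ac: vector_space "\<lambda>(c::'a::{field,finite}) x. to_ac c * x"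
  by unfold_locales (simp_all add: distrib_left distrib_right mult.assoc)

lemma Frobenius_diff:
  fixes x y :: "'a::{field,finite} alg_closure"
  assumes "primepow CARD('a)"
  shows "(x - y) ^ (CARD('a) ^ n) = x ^ (CARD('a) ^ n) - y ^ (CARD('a) ^ n)"
  using Frobenius_add[OF assms, of "x - y" y n] by (simp add: algebra_simps)

lemma Frobenius_sum:
  fixes f :: "'b \<Rightarrow> 'a::{field,finite} alg_closure"
  assumes "primepow CARD('a)"
  shows "sum f A ^ (CARD('a) ^ n) = (\<Sum>i\<in>A. f i ^ (CARD('a) ^ n))"
  by (induction A rule: infinite_finite_induct) (simp_all add: Frobenius_add[OF assms] power_0_left)

lemma to_ac_power_CARD_power: "to_ac c ^ (CARD('a) ^ n) = to_ac c" for c :: "'a::{field,finite}"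
  by (induction n) (simp_all add: power_mult power_CARD_eq flip: to_ac_power)

text \<open>This is the subspace polynomial, built one basis vector at a time: if \<open>L\<close>
  has kernel \<open>span B\<close>, then \<open>L ^ q - L(w) ^ (q - 1) * L\<close> has kernel
  \<open>span (insert w B)\<close>. The lowest coefficient stays nonzero because \<open>L(w)\<close>
  is nonzero.\<close>

lemma linearized_polynomial_of_span:
  fixes B :: "'a::{field,finite} alg_closure set"
  assumes pp: "primepow CARD('a)" and "finite B" "ac.independent B"
  shows "\<exists>f. f 0 \<noteq> 0 \<and> f (card B) = 1 \<and>
           (\<forall>x. (\<Sum>i\<le>card B. f i * x ^ (CARD('a) ^ i)) = 0 \<longleftrightarrow> x \<in> ac.span B)"
  using assms(2,3)
proof (induction B rule: finite_induct)
  case empty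
  show ?case
    by (intro exI[of _ "\<lambda>_. 1"]) auto
next
  case (insert w B)
  define q where "q = CARD('a)"
  have "q > 0"
    by (simp add: q_def)
  have ind: "ac.independent B" and w: "w \<notin> ac.span B"
    using insert.prems insert.hyps by (simp_all add: ac.independent_insert)
  obtain f where f: "f 0 \<noteq> 0" "f (card B) = 1"
    and ker: "\<And>x. (\<Sum>i\<le>card B. f i * x ^ (q ^ i)) = 0 \<longleftrightarrow> x \<in> ac.span B"
    using insert.IH[OF ind] by (auto simp: q_def)
  define L where "L x = (\<Sum>i\<le>card B. f i * x ^ (q ^ i))" for x
  have L_diff: "L (x - y) = L x - L y" for x y
    by (simp add: L_def q_def Frobenius_diff[OF pp] right_diff_distrib sum_subtractf)
  have L_scale: "L (to_ac c * x) = to_ac c * L x" for c x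
    by (simp add: L_def q_def power_mult_distrib to_ac_power_CARD_power sum_distrib_left mult_ac)
  have Lw: "L w \<noteq> 0"
    using ker w by (simp add: L_def)
  \<comment> \<open>With this value \<open>w\<close> becomes a root of
    \<open>L x ^ q - \<gamma> * L x\<close>.\<close>
  define \<gamma> where "\<gamma> = L w ^ (q - 1)"
  \<comment> \<open>Raising \<open>L\<close> to the power \<open>q\<close> moves every coefficient
    up one index, leaving 0 at index 0; \<open>\<gamma> * L\<close> contributes nothing at the new
    top index.\<close>
  define f' where "f' i = (if i = 0 then 0 else f (i - 1) ^ q) -
    (if i \<le> card B then \<gamma> * f i else 0)" for i
  have eq: "(\<Sum>i\<le>Suc (card B). f' i * x ^ (q ^ i)) = L x ^ q - \<gamma> * L x" for x
  proof -
    have "L x ^ q = (\<Sum>i\<le>card B. f i ^ q * x ^ (q ^ Suc i))"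
      using Frobenius_sum[OF pp, of "\<lambda>i. f i * x ^ (q ^ i)" "{..card B}" 1]
      by (simp add: L_def q_def power_mult_distrib mult.commute flip: power_mult)
    also have "\<dots> = (\<Sum>i\<le>Suc (card B). (if i = 0 then 0 else f (i - 1) ^ q) * x ^ (q ^ i))"
      by (subst sum.atMost_Suc_shift) simp
    finally have 1: "L x ^ q = \<dots>" .
    have "(\<Sum>i\<le>Suc (card B). (if i \<le> card B then \<gamma> * f i else 0) * x ^ (q ^ i)) = \<gamma> * L x"
      by (simp add: L_def sum_distrib_left mult_ac)
    with 1 show ?thesis
      by (simp only: f'_def left_diff_distrib sum_subtractf)
  qed
  have "L x ^ q - \<gamma> * L x = 0 \<longleftrightarrow> x \<in> ac.span (insert w B)" for x
  proof -
    have Lq: "y ^ q = y * y ^ (q - 1)" for y :: "'a alg_closure"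
      using \<open>q > 0\<close> by (simp flip: power_Suc)
    \<comment> \<open>The quotient \<open>L x / L w\<close> is fixed by Frobenius, so it is a scalar
      \<open>c\<close> of the base field, and \<open>x - c w\<close> lies in the old kernel.\<close>
    have "L x ^ q - \<gamma> * L x = 0 \<longleftrightarrow> (L x / L w) ^ q = L x / L w"
      using Lw by (simp add: \<gamma>_def power_divide Lq[of "L w"] field_simps)
    also have "\<dots> \<longleftrightarrow> (\<exists>c. L x / L w = to_ac c)"
      using range_to_ac_eq[where ?'a='a] by (auto simp: q_def)
    also have "\<dots> \<longleftrightarrow> (\<exists>c. L (x - to_ac c * w) = 0)"
      using Lw by (simp add: L_diff L_scale nonzero_divide_eq_eq)
    also have "\<dots> \<longleftrightarrow> x \<in> ac.span (insert w B)"
      by (simp add: ac.span_insert ker flip: L_def) (simp add: L_def ker)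
    finally show ?thesis .
  qed
  moreover have "f' 0 \<noteq> 0" "f' (Suc (card B)) = 1"
    using f Lw by (auto simp: f'_def \<gamma>_def)
  ultimately show ?case
    using insert.hyps by (intro exI[of _ f']) (simp add: eq flip: q_def del: sum.atMost_Suc)
qed

section \<open>Sums of geometric sequences, roots of unity and twisted Frobenius maps\<close>

text \<open>Weight the equations with the coefficients of the product \<open>p\<close> of all
  \<open>X - h j\<close>. Each geometric sequence is annihilated, even if ratios coincide, and what
  remains is \<open>c * p(1)\<close> with \<open>p(1)\<close> nonzero.\<close>

lemma constant_term_eq_0_of_geometric:
  fixes A h :: "'b \<Rightarrow> 'k::field"
  assumes "finite J" and sum0: "\<And>i. i \<le> card J \<Longrightarrow> c + (\<Sum>j\<in>J. A j * h j ^ i) = 0"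
    and "\<And>j. j \<in> J \<Longrightarrow> h j \<noteq> 1"
  shows "c = 0"
proof -
  define p where "p = (\<Prod>j\<in>J. [:- h j, 1:])"
  have deg: "degree p = card J"
    by (simp add: p_def degree_prod_eq_sum_degree)
  have root: "poly p (h j) = 0" if "j \<in> J" for j
    using that \<open>finite J\<close> by (auto simp: p_def poly_prod)
  have "0 = (\<Sum>i\<le>degree p. poly.coeff p i * (c + (\<Sum>j\<in>J. A j * h j ^ i)))"
    using sum0 by (simp add: deg)
  also have "\<dots> = c * poly p 1 + (\<Sum>i\<le>degree p. \<Sum>j\<in>J. A j * (poly.coeff p i * h j ^ i))"
    by (simp add: poly_altdef distrib_left sum.distrib sum_distrib_left mult_ac)
  also have "\<dots> = c * poly p 1 + (\<Sum>j\<in>J. A j * poly p (h j))"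
    by (subst sum.swap) (simp add: poly_altdef sum_distrib_left)
  also have "\<dots> = c * poly p 1"
    using root by simp
  finally show ?thesis
    using assms(1,3) by (auto simp: p_def poly_prod)
qed

lemma card_roots_unity_separable:
  assumes "of_nat n \<noteq> (0 :: 'k::alg_closed_field)"
  shows "card {x :: 'k. x ^ n = 1} = n"
proof -
  let ?p = "Polynomial.monom 1 n - 1 :: 'k poly"
  have n: "n > 0"
    using assms by (cases n) auto
  have deg: "degree ?p = n"
    using n by (simp add: degree_add_eq_left degree_monom_eq diff_conv_add_uminus del: add_uminus_conv_diff)
  have "card {x. poly ?p x = 0} = degree ?p"
  proof (rule card_roots_separable)
    show "?p \<noteq> 0"
      using deg n by force
    show "poly (pderiv ?p) x \<noteq> 0" if "poly ?p x = 0" for x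
      using that n assms by (auto simp: poly_monom pderiv_diff pderiv_monom power_0_left)
  qed
  then show ?thesis
    unfolding deg by (simp add: poly_monom)
qed

text \<open>The derivative of \<open>X ^ (q ^ n) - u X\<close> is the nonzero constant
  \<open>- u\<close>, because \<open>q\<close> vanishes in the field; hence all roots are
  simple.\<close>

lemma card_twisted_Frobenius:
  fixes u :: "'a::{field,finite} alg_closure"
  assumes "u \<noteq> 0" "n > 0"
  shows "card {x. x ^ (CARD('a) ^ n) = u * x} = CARD('a) ^ n"
proof -
  let ?p = "Polynomial.monom 1 (CARD('a) ^ n) - [:0, u:]"
  have "CARD('a) > 1"
    using CARD_field_ge_2[where ?'a='a] by simp
  then have Q: "CARD('a) ^ n > 1"
    using assms(2) by (metis one_less_power)
  then have deg: "degree ?p = CARD('a) ^ n"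
    using assms(1)
    by (simp add: degree_add_eq_left degree_monom_eq diff_conv_add_uminus del: add_uminus_conv_diff)
  have "card {x. poly ?p x = 0} = degree ?p"
  proof (rule card_roots_separable)
    show "?p \<noteq> 0"
      using deg Q by force
    show "poly (pderiv ?p) x \<noteq> 0" for x
      using assms
      by (simp add: pderiv_diff pderiv_monom pderiv_pCons of_nat_CARD_alg_closure poly_monom power_0_left)
  qed
  then show ?thesis
    unfolding deg by (simp add: poly_monom mult.commute)
qed

section \<open>Divisors of \<open>q ^ 2 - q + 1\<close> and the powers of \<open>g\<close> that
  equal 1\<close>

text \<open>By Bezout, \<open>g\<close> to the power \<open>gcd m e\<close> is 1. The hypothesis
  speaks of common divisors because those are what the divisibility arguments below control.\<close>

lemma power_eq_1_of_dvd_3: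
  fixes g :: "'m::monoid_mult"
  assumes g: "g ^ m = 1" "g ^ e = 1" and m: "m > 0"
    and 3: "\<And>d. d dvd m \<Longrightarrow> d dvd e \<Longrightarrow> d dvd 3"
  shows "g ^ 3 = 1"
proof -
  obtain x y where xy: "m * x = e * y + gcd m e"
    using bezout_nat[of m e] m by auto
  have "g ^ (m * x) = g ^ (e * y) * g ^ gcd m e"
    by (simp only: xy power_add)
  then have "g ^ gcd m e = 1"
    using g by (simp add: power_mult)
  moreover have "gcd m e dvd 3"
    by (intro 3) auto
  ultimately show ?thesis
    by (metis dvdE power_mult power_one)
qed

text \<open>The number is the sixth cyclotomic polynomial at \<open>q\<close>. Over the integers it
  can enter combinations with negative coefficients.\<close>

lemma of_nat_cyclotomic6: "int (q * (q - 1) + 1) = int q * (int q - 1) + 1"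
  by (cases q) (simp_all add: algebra_simps)

text \<open>These are the exponents of \<open>g\<close> in the nonconstant monomials of a polynomial that has degree at
  most 1 in each of \<open>u = g\<close>, \<open>u ^ q\<close> and \<open>u ^ q\<^sup>2\<close>; the exponent \<open>1 + q\<^sup>2\<close> is missing because
  \<open>g ^ (1 + q\<^sup>2) = g ^ q\<close>.\<close>

lemma cyclotomic6_exponents:
  fixes q :: nat and g :: "'m::monoid_mult"
  assumes q: "q \<ge> 2" and g: "g ^ (q * (q - 1) + 1) = 1" "g ^ 3 \<noteq> 1"
    and e: "e \<in> {1, q, q\<^sup>2, q + 1, q + q\<^sup>2, 1 + q + q\<^sup>2}"
  shows "g ^ e \<noteq> 1"
proof
  assume "g ^ e = 1"
  have "d dvd 3" if d: "d dvd q * (q - 1) + 1" "d dvd e" for d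
  proof -
    define Q D :: int where "Q = int q" and "D = int d"
    have D: "D dvd Q * (Q - 1) + 1"
      using d(1) unfolding D_def Q_def of_nat_cyclotomic6[symmetric] by (simp only: of_nat_dvd_iff)
    have De: "D dvd int e"
      using d(2) by (simp add: D_def)
    \<comment> \<open>The multipliers \<open>s\<close> and \<open>r\<close> supplied below are
      polynomials in \<open>Q\<close> that express 3 as a combination of
      \<open>Q ^ 2 - Q + 1\<close> and the exponent.\<close>
    have comb: "D dvd 3" if "D dvd t" "s * (Q * (Q - 1) + 1) - r * t = 3" for r s t
      using that D by (metis dvd_diff dvd_mult)
    have "D dvd 3"
    proof -
      consider "e = 1" | "e = q" | "e = q\<^sup>2" | "e = q + 1" | "e = q + q\<^sup>2" | "e = 1 + q + q\<^sup>2"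
        using e by blast
      then show ?thesis
      proof cases
        case 1
        then show ?thesis using d by (simp add: D_def)
      next
        case 2
        then have "D dvd Q" using De by (simp add: Q_def add_ac)
        then show ?thesis
          by (rule comb[where s=3 and r="3 * (Q - 1)"]) (simp add: algebra_simps)
      next
        case 3
        then have "D dvd Q\<^sup>2" using De by (simp add: Q_def add_ac)
        then show ?thesis
          by (rule comb[where s="3 * (Q + 1)" and r="3 * Q"]) (simp add: algebra_simps power2_eq_square)
      next
        case 4
        then have "D dvd Q + 1" using De by (simp add: Q_def add_ac)
        then show ?thesis
          by (rule comb[where s=1 and r="Q - 2"]) (simp add: algebra_simps)
      next
        case 5
        then have "D dvd Q + Q\<^sup>2" using De by (simp add: Q_def add_ac)
        then show ?thesis
          by (rule comb[where s="2 * Q + 3" and r="2 * Q - 1"]) (simp add: algebra_simps power2_eq_square)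
      next
        case 6
        then have "D dvd 1 + Q + Q\<^sup>2"
          using De by (simp add: Q_def add_ac)
        \<comment> \<open>Here the combination \<open>(Q ^ 3 + 1) - (Q ^ 3 - 1)\<close> gives 2 in
          place of 3; since \<open>Q ^ 2 - Q + 1\<close> is odd, only \<open>d = 1\<close>
          remains.\<close>
        then have "D dvd (Q + 1) * (Q * (Q - 1) + 1) - (Q - 1) * (1 + Q + Q\<^sup>2)"
          using D by (intro dvd_diff dvd_mult)
        also have "\<dots> = 2"
          by (simp add: algebra_simps power2_eq_square)
        finally have "D dvd int 2" by simp
        then have "d dvd 2"
          unfolding D_def by (simp only: of_nat_dvd_iff)
        moreover have "odd (Q * (Q - 1) + 1)"
          by simp
        then have "odd D"
          using D dvd_trans by blast
        ultimately have "d = 1"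
          using prime_nat_iff two_is_prime_nat by (auto simp: D_def)
        then show ?thesis
          by (simp add: D_def)
      qed
    qed
    then show "d dvd 3"
      unfolding D_def by (metis of_nat_dvd_iff of_nat_numeral)
  qed
  then show False
    using power_eq_1_of_dvd_3[OF g(1) \<open>g ^ e = 1\<close>] g(2) by simp
qed

text \<open>This makes \<open>g ^ 0, ..., g ^ 6\<close> distinct. The number
  \<open>q ^ 2 - q + 1\<close> is odd and never divisible by 5, so its only possible divisors up to
  6 are 1 and 3.\<close>

lemma cyclotomic6_small_exponents:
  fixes q :: nat and g :: "'m::monoid_mult"
  assumes g: "g ^ (q * (q - 1) + 1) = 1" "g ^ 3 \<noteq> 1" and e: "0 < e" "e < 7"
  shows "g ^ e \<noteq> 1"
proof
  assume "g ^ e = 1"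
  have "d dvd 3" if d: "d dvd q * (q - 1) + 1" "d dvd e" for d
  proof -
    have "odd (q * (q - 1) + 1)"
      by (cases q) auto
    then have "odd d"
      using d(1) dvd_trans by blast
    moreover have "\<not> 5 dvd q * (q - 1) + 1"
    proof -
      define r where "r = int q mod 5"
      have "r \<in> {0, 1, 2, 3, 4}"
        by (auto simp: r_def)
      then have "(r * (r - 1) + 1) mod 5 \<noteq> 0"
        by auto
      moreover have "(r * (r - 1) + 1) mod 5 = (int q * (int q - 1) + 1) mod 5"
        unfolding r_def by (intro mod_add_cong mod_mult_cong mod_diff_cong) simp_all
      ultimately have "\<not> int 5 dvd int (q * (q - 1) + 1)"
        unfolding of_nat_cyclotomic6 by (simp add: dvd_eq_mod_eq_0)
      then show ?thesis
        by (simp only: of_nat_dvd_iff not_False_eq_True)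
    qed
    then have "d \<noteq> 5"
      using d(1) by blast
    moreover have "d \<le> 6" "d > 0"
      using d(2) e dvd_imp_le[of d e] dvd_pos_nat by auto
    moreover from this have "d = 1 \<or> d = 2 \<or> d = 3 \<or> d = 4 \<or> d = 5 \<or> d = 6"
      by linarith
    ultimately show ?thesis by auto
  qed
  then show False
    using power_eq_1_of_dvd_3[OF g(1) \<open>g ^ e = 1\<close>] g(2) by simp
qed

section \<open>The determinant that excludes a common transversal plane\<close>

text \<open>Cramer's rule: combining the three equations with the cofactors of the first column
  eliminates \<open>y\<close> and \<open>w\<close> and leaves the determinant times
  \<open>x\<close>.\<close>

lemma det3_eq_0:
  fixes x y w :: "'k::field"
  assumes "(c + u) * x + b * y + a * w = 0"
    and "a1 * (u * x) + (c1 + u1) * y + b1 * w = 0"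
    and "b2 * (u * x) + a2 * (u1 * y) + (c2 + u2) * w = 0"
    and "x \<noteq> 0"
  shows "(c + u) * ((c1 + u1) * (c2 + u2) - b1 * a2 * u1) - b * (a1 * u * (c2 + u2) - b1 * b2 * u)
    + a * (a1 * a2 * u * u1 - (c1 + u1) * b2 * u) = 0" (is "?D = 0")
proof -
  have "?D * x = ((c1 + u1) * (c2 + u2) - b1 * a2 * u1) * ((c + u) * x + b * y + a * w)
     - (b * (c2 + u2) - a * a2 * u1) * (a1 * (u * x) + (c1 + u1) * y + b1 * w)
     + (b * b1 - a * (c1 + u1)) * (b2 * (u * x) + a2 * (u1 * y) + (c2 + u2) * w)"
    by (simp add: algebra_simps)
  then have "?D * x = 0"
    by (simp only: assms(1-3)) simp
  with assms(4) show ?thesis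
    by simp
qed

text \<open>The \<open>q\<close>-polynomial annihilating \<open>z i\<close> and its first two Frobenius twists are linear equations
  for \<open>z i\<close>, \<open>z i ^ q\<close>, \<open>z i ^ q\<^sup>2\<close>, so their determinant vanishes. It is a polynomial in
  \<open>u = g ^ i\<close>, \<open>u ^ q\<close>, \<open>u ^ q\<^sup>2\<close> with constant term \<open>c ^ (1 + q + q\<^sup>2)\<close>.\<close>

lemma no_common_transversal:
  fixes a b c g :: "'a::{field,finite} alg_closure" and z :: "nat \<Rightarrow> 'a alg_closure"
  assumes pp: "primepow CARD('a)"
  defines "q \<equiv> CARD('a)"
  assumes g: "g ^ (q * (q - 1) + 1) = 1" "g ^ 3 \<noteq> 1" and "c \<noteq> 0"
    and z0: "\<And>i. i < 7 \<Longrightarrow> z i \<noteq> 0"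
    and z: "\<And>i. i < 7 \<Longrightarrow> z i ^ (q ^ 3) = g ^ i * z i"
    and ann: "\<And>i. i < 7 \<Longrightarrow> c * z i + b * z i ^ q + a * z i ^ (q\<^sup>2) + z i ^ (q ^ 3) = 0"
  shows False
proof -
  have q2: "q \<ge> 2"
    unfolding q_def by (rule CARD_field_ge_2)
  have frob: "(x + y) ^ q = x ^ q + y ^ q" for x y :: "'a alg_closure"
    using Frobenius_add[OF pp, of x y 1] by (simp add: q_def)
  define a1 a2 b1 b2 c1 c2 where "a1 = a ^ q" and "a2 = a1 ^ q" and "b1 = b ^ q" and "b2 = b1 ^ q"
    and "c1 = c ^ q" and "c2 = c1 ^ q"
  have rel: "g ^ (1 + q\<^sup>2) = g ^ q"
  proof -
    have "1 + q\<^sup>2 = (q * (q - 1) + 1) + q"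
      using q2 by (simp add: power2_eq_square algebra_simps)
    then show ?thesis
      using g(1) by (simp only: power_add) simp
  qed
  define e where "e = [1, q, q\<^sup>2, q + 1, q + q\<^sup>2, 1 + q + q\<^sup>2]"
  \<comment> \<open>These are the coefficients of the determinant at the monomials with exponents
    \<open>e\<close>. The coefficient \<open>c1 - b * a1\<close> of \<open>u * u ^ (q ^ 2)\<close>
    has been merged into that of \<open>u ^ q\<close>.\<close>
  define A where "A = [c1 * c2 - b * a1 * c2 + b * b1 * b2 - a * c1 * b2,
    c * c2 - c * b1 * a2 + c1 - b * a1, c * c1, c2 - b1 * a2 + a * a1 * a2 - a * b2, c, 1]"
  \<comment> \<open>Six ratios call for the seven equations \<open>i = 0, ..., 6\<close>.\<close>
  have "c * c1 * c2 = 0"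
  proof (rule constant_term_eq_0_of_geometric[where J="{..<6}" and A="(!) A" and h="\<lambda>j. g ^ (e ! j)"])
    fix i :: nat assume "i \<le> card {..<6::nat}"
    then have i: "i < 7" by simp
    define u where "u = g ^ i"
    define x y w where "x = z i" and "y = x ^ q" and "w = y ^ q"
    \<comment> \<open>Up to the factor \<open>u\<close>, Frobenius permutes \<open>x\<close>,
      \<open>y\<close>, \<open>w\<close> cyclically, so twisting an equation introduces no fourth
      unknown.\<close>
    have w: "w = x ^ (q\<^sup>2)" and wq: "w ^ q = u * x"
      using z[OF i] by (simp_all add: w_def y_def x_def u_def power2_eq_square power3_eq_cube flip: power_mult)
    have 1: "(c + u) * x + b * y + a * w = 0"
      using ann[OF i] z[OF i] by (simp add: w y_def u_def algebra_simps flip: x_def)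
    from arg_cong[OF 1, of "\<lambda>x. x ^ q"]
    have 2: "a1 * (u * x) + (c1 + u ^ q) * y + b1 * w = 0"
      using q2 by (simp add: frob power_mult_distrib wq a1_def b1_def c1_def add_ac flip: y_def w_def)
    from arg_cong[OF 2, of "\<lambda>x. x ^ q"]
    have 3: "b2 * (u * x) + a2 * (u ^ q * y) + (c2 + (u ^ q) ^ q) * w = 0"
      using q2 by (simp add: frob power_mult_distrib wq a2_def b2_def c2_def add_ac flip: y_def w_def)
    have rel_u: "u * (u ^ q) ^ q = u ^ q"
    proof -
      have "u * (u ^ q) ^ q = (g ^ (1 + q\<^sup>2)) ^ i"
        by (simp add: u_def power2_eq_square mult_ac power_add power_mult_distrib flip: power_mult)
      also have "\<dots> = u ^ q"
        unfolding rel by (simp add: u_def mult_ac flip: power_mult)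
      finally show ?thesis .
    qed
    define v t where "v = u ^ q" and "t = v ^ q"
    have rel_t: "u * t = v"
      using rel_u by (simp add: v_def t_def)
    have pow: "(g ^ 1) ^ i = u" "(g ^ q) ^ i = v" "(g ^ q\<^sup>2) ^ i = t" "(g ^ (q + 1)) ^ i = u * v"
       "(g ^ (q + q\<^sup>2)) ^ i = v * t" "(g ^ (1 + q + q\<^sup>2)) ^ i = u * v * t"
      by (simp_all add: u_def v_def t_def power_add power2_eq_square power_mult_distrib mult_ac
          flip: power_mult)
    have sum6: "(\<Sum>j<6. A ! j * H j) = (c1 * c2 - b * a1 * c2 + b * b1 * b2 - a * c1 * b2) * u
      + (c * c2 - c * b1 * a2 + c1 - b * a1) * v + c * c1 * t
      + (c2 - b1 * a2 + a * a1 * a2 - a * b2) * (u * v) + c * (v * t) + u * v * t"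
      if "H 0 = u" "H 1 = v" "H 2 = t" "H 3 = u * v" "H 4 = v * t" "H 5 = u * v * t" for H
      using that by (simp add: A_def lessThan_Suc numeral_eq_Suc add_ac)
    have "(\<Sum>j<6. A ! j * (g ^ (e ! j)) ^ i) = (c1 * c2 - b * a1 * c2 + b * b1 * b2 - a * c1 * b2) * u
      + (c * c2 - c * b1 * a2 + c1 - b * a1) * v + c * c1 * t
      + (c2 - b1 * a2 + a * a1 * a2 - a * b2) * (u * v) + c * (v * t) + u * v * t"
      by (rule sum6) (simp_all add: e_def pow[simplified])
    also have "c * c1 * c2 + \<dots> =
      (c + u) * ((c1 + v) * (c2 + t) - b1 * a2 * v) - b * (a1 * u * (c2 + t) - b1 * b2 * u)
      + a * (a1 * a2 * u * v - (c1 + v) * b2 * u)"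
      by (simp add: algebra_simps) (simp add: algebra_simps flip: rel_t)
    also have "\<dots> = 0"
      by (rule det3_eq_0[of c u x b y a w a1 c1 v b1 b2 a2 c2 t])
        (use 1 2 3 z0[OF i] in \<open>simp_all add: v_def t_def x_def\<close>)
    finally show "c * c1 * c2 + (\<Sum>j<6. A ! j * (g ^ (e ! j)) ^ i) = 0" .
  next
    fix j :: nat assume "j \<in> {..<6}"
    then have "e ! j \<in> set e"
      by (intro nth_mem) (simp add: e_def)
    also have "set e = {1, q, q\<^sup>2, q + 1, q + q\<^sup>2, 1 + q + q\<^sup>2}"
      by (simp only: e_def set_simps)
    finally show "g ^ (e ! j) \<noteq> 1"
      by (rule cyclotomic6_exponents[OF q2 g])
  qed simp
  with \<open>c \<noteq> 0\<close> show False
    by (simp add: c1_def c2_def)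
qed

section \<open>Seven spread elements for \<open>q \<ge> 3\<close>\<close>

definition spread_element :: "'a::{field,finite} alg_closure \<Rightarrow> 'a alg_closure set" where
  "spread_element u = {x. x ^ (CARD('a) ^ 3) = u * x}"

text \<open>The exponent \<open>q * (q - 1) + 1\<close> equals 1 in the field, so there are that
  many roots of unity. From \<open>q \<ge> 3\<close> on these are at least 7, of which at most 3
  have cube 1.\<close>

lemma ex_cyclotomic6_root:
  assumes "CARD('a::{field,finite}) \<ge> 3"
  shows "\<exists>g :: 'a alg_closure. g ^ (CARD('a) * (CARD('a) - 1) + 1) = 1 \<and> g ^ 3 \<noteq> 1"
proof (rule ccontr)
  let ?n = "CARD('a) * (CARD('a) - 1) + 1"
  let ?p = "Polynomial.monom 1 3 - 1 :: 'a alg_closure poly"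
  have "3 * 2 \<le> CARD('a) * (CARD('a) - 1)"
    using assms by (intro mult_mono) auto
  then have n: "?n \<ge> 7"
    by simp
  have deg: "degree ?p = 3"
    by (simp add: degree_add_eq_left degree_monom_eq diff_conv_add_uminus del: add_uminus_conv_diff)
  then have p: "?p \<noteq> 0"
    by force
  assume "\<not> ?thesis"
  then have "{x :: 'a alg_closure. x ^ ?n = 1} \<subseteq> {x. poly ?p x = 0}"
    by (auto simp: poly_monom)
  then have "card {x :: 'a alg_closure. x ^ ?n = 1} \<le> card {x. poly ?p x = 0}"
    by (rule card_mono[OF poly_roots_finite[OF p]])
  also have "\<dots> \<le> 3"
    using card_poly_roots_bound[OF p] unfolding deg .
  finally have "card {x :: 'a alg_closure. x ^ ?n = 1} \<le> 3" .
  moreover have "card {x :: 'a alg_closure. x ^ ?n = 1} = ?n"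
    by (rule card_roots_unity_separable) (simp add: of_nat_CARD_alg_closure)
  ultimately show False
    using n by linarith
qed

lemma linearized_polynomial_of_subspace:
  fixes W :: "'a::{field,finite} alg_closure set"
  assumes pp: "primepow CARD('a)" and W: "ac.subspace W" "card W = CARD('a) ^ n"
  shows "\<exists>f. f 0 \<noteq> 0 \<and> f n = 1 \<and> (\<forall>x. (\<Sum>i\<le>n. f i * x ^ (CARD('a) ^ i)) = 0 \<longleftrightarrow> x \<in> W)"
proof -
  obtain B where B: "B \<subseteq> W" "ac.independent B" "W \<subseteq> ac.span B"
    by (rule ac.basis_exists[of W])
  have span: "ac.span B = W"
    by (rule ac.span_subspace[OF B(1,3) W(1)])
  have "finite W"
    using W(2) by (intro card_ge_0_finite) simp
  then have "finite B"
    using B(1) finite_subset by blast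
  from card_span_independent[OF ac.vector_space_axioms this B(2)]
  have "CARD('a) ^ card B = CARD('a) ^ n"
    by (simp only: span W(2))
  then have "card B = n"
    using CARD_field_ge_2[where ?'a='a] by (simp add: power_inject_exp)
  then show ?thesis
    using linearized_polynomial_of_span[OF pp \<open>finite B\<close> B(2)] by (simp only: span)
qed

lemma spread_elements_geometric:
  assumes pp: "primepow CARD('a::{field,finite})" and q: "CARD('a) \<ge> 3"
  shows "\<exists>S :: 'a alg_closure set. card S = 7 \<and> (\<forall>u\<in>S. u ^ (CARD('a) ^ 3 + 1) = 1) \<and>
    (\<forall>W. ac.subspace W \<longrightarrow> card W = CARD('a) ^ 3 \<longrightarrow> (\<exists>u\<in>S. spread_element u \<inter> W \<subseteq> {0}))"
proof -
  define q where "q = CARD('a)"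
  obtain g :: "'a alg_closure" where g: "g ^ (q * (q - 1) + 1) = 1" "g ^ 3 \<noteq> 1"
    using ex_cyclotomic6_root[OF q] by (auto simp: q_def)
  define S where "S = (\<lambda>i. g ^ i) ` {..<7::nat}"
  have g0: "g \<noteq> 0"
    using g(1) by (auto simp: power_0_left)
  have "inj_on (\<lambda>i. g ^ i) {..<7::nat}"
  proof (rule linorder_inj_onI')
    fix i j :: nat assume "i \<in> {..<7}" "j \<in> {..<7}" "i < j"
    then have "g ^ (j - i) \<noteq> 1"
      by (intro cyclotomic6_small_exponents[OF g]) auto
    moreover have "g ^ j = g ^ i * g ^ (j - i)"
      using \<open>i < j\<close> by (simp flip: power_add)
    ultimately show "g ^ i \<noteq> g ^ j"
      using g0 by auto
  qed
  then have "card S = 7"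
    by (simp add: S_def card_image)
  moreover have "u ^ (q ^ 3 + 1) = 1" if "u \<in> S" for u
  proof -
    have "q ^ 3 + 1 = (q * (q - 1) + 1) * (q + 1)"
      by (cases q) (simp_all add: power3_eq_cube algebra_simps)
    then have "g ^ (q ^ 3 + 1) = 1"
      by (simp only: power_mult g(1) power_one)
    moreover obtain i where u: "u = g ^ i"
      using \<open>u \<in> S\<close> unfolding S_def by blast
    have "u ^ (q ^ 3 + 1) = (g ^ (q ^ 3 + 1)) ^ i"
      unfolding u power_mult[symmetric] by (simp only: mult.commute)
    ultimately show ?thesis
      by simp
  qed
  moreover have "\<exists>u\<in>S. spread_element u \<inter> W \<subseteq> {0}"
    if W: "ac.subspace W" "card W = q ^ 3" for W
  proof (rule ccontr)
    assume "\<not> ?thesis"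
    then have "\<forall>i<7. \<exists>z. z ^ (q ^ 3) = g ^ i * z \<and> z \<in> W \<and> z \<noteq> 0"
      by (auto simp: S_def spread_element_def q_def)
    then obtain z where z: "\<And>i. i < 7 \<Longrightarrow> z i ^ (q ^ 3) = g ^ i * z i"
      "\<And>i. i < 7 \<Longrightarrow> z i \<in> W" "\<And>i. i < 7 \<Longrightarrow> z i \<noteq> 0"
      by metis
    \<comment> \<open>The subspace polynomial of \<open>W\<close> has \<open>q\<close>-degree 3;
      \<open>f 0\<close>, \<open>f 1\<close>, \<open>f 2\<close> become \<open>c\<close>,
      \<open>b\<close>, \<open>a\<close> in the determinant argument.\<close>
    obtain f where f: "f 0 \<noteq> 0" "f 3 = 1"
      and ker: "\<And>x. (\<Sum>i\<le>3. f i * x ^ (q ^ i)) = 0 \<longleftrightarrow> x \<in> W"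
      using linearized_polynomial_of_subspace[OF pp W[unfolded q_def]] by (auto simp: q_def)
    have sum3: "(\<Sum>i\<le>3. F i) = F 0 + F 1 + F 2 + F 3" for F :: "nat \<Rightarrow> 'a alg_closure"
      by (simp add: numeral_eq_Suc)
    show False
    proof (rule no_common_transversal[OF pp, folded q_def, OF g f(1) z(3,1)])
      show "f 0 * z i + f 1 * z i ^ q + f 2 * z i ^ q\<^sup>2 + z i ^ q ^ 3 = 0" if "i < 7" for i
        using iffD2[OF ker z(2)[OF that]] unfolding sum3 f(2) by simp
    qed
  qed
  ultimately show ?thesis
    unfolding q_def by blast
qed

section \<open>Seven spread elements for \<open>q = 2\<close>\<close>

lemma subspace_twisted_Frobenius:
  fixes u :: "'a::{field,finite} alg_closure"
  assumes "primepow CARD('a)"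
  shows "ac.subspace {x. x ^ (CARD('a) ^ n) = u * x}"
  by (rule ac.subspaceI)
    (auto simp: Frobenius_add[OF assms] power_mult_distrib to_ac_power_CARD_power distrib_left power_0_left)

text \<open>The count concerns the vectors of \<open>K\<close> outside \<open>W\<close>, hence a
  condition on pairs \<open>W\<close>, \<open>K\<close> instead of on \<open>W\<close>
  alone.\<close>

lemma spread_elements_binary:
  assumes pp: "primepow CARD('a::{field,finite})" and q: "CARD('a) = 2"
  shows "\<exists>S :: 'a alg_closure set. card S = 7 \<and> (\<forall>u\<in>S. u ^ (CARD('a) ^ 3 + 1) = 1) \<and>
    (\<forall>W K. ac.subspace W \<longrightarrow> ac.subspace K \<longrightarrow> W \<subseteq> K \<longrightarrow> K \<subseteq> {x. x ^ (CARD('a) ^ 6) = x} \<longrightarrow>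
       card W = CARD('a) ^ 3 \<longrightarrow> card K = CARD('a) ^ 4 \<longrightarrow> (\<forall>u\<in>S. spread_element u \<inter> K \<subseteq> W) \<longrightarrow>
       (\<exists>u\<in>S. spread_element u \<inter> W \<subseteq> {0}))"
proof -
  \<comment> \<open>Since \<open>9 = 2 ^ 3 + 1\<close>, this set parametrizes all spread
    elements.\<close>
  define M :: "'a alg_closure set" where "M = {x. x ^ 9 = 1}"
  have two: "(2 :: 'a alg_closure) = 0"
    using of_nat_CARD_alg_closure[where ?'a='a] q by simp
  have "of_nat 9 = (1 + 2 * 4 :: 'a alg_closure)"
    by simp
  then have "of_nat 9 \<noteq> (0 :: 'a alg_closure)"
    by (simp only: two) simp
  then have M: "card M = 9"
    unfolding M_def by (rule card_roots_unity_separable)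
  then have finM: "finite M"
    by (intro card_ge_0_finite) simp
  from M obtain S where S: "S \<subseteq> M" "card S = 7" "finite S"
    using obtain_subset_with_card_n[of 7 M] by auto
  have "\<exists>u\<in>S. spread_element u \<inter> W \<subseteq> {0}"
    if W: "ac.subspace W" and K: "ac.subspace K" and "W \<subseteq> K" and K6: "K \<subseteq> {x. x ^ 64 = x}"
      and cW: "card W = 8" and cK: "card K = 16" and SK: "\<forall>u\<in>S. spread_element u \<inter> K \<subseteq> W" for W K
  proof (rule ccontr)
    assume none: "\<not> ?thesis"
    \<comment> \<open>As \<open>7 = 2 ^ 3 - 1\<close>, \<open>f z\<close> is the parameter of the
      unique spread element through a nonzero \<open>z\<close>.\<close>
    define f :: "'a alg_closure \<Rightarrow> _" where "f z = z ^ 7" for z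
    have spread: "z \<in> spread_element (f z)" for z
      by (simp add: spread_element_def q f_def flip: power_Suc2)
    have f_eq: "f z = u" if "z \<in> spread_element u" "z \<noteq> 0" for z u
    proof -
      have "z ^ 7 * z = u * z"
        using that(1) by (simp add: spread_element_def q flip: power_Suc2)
      then show ?thesis
        using that(2) by (simp add: f_def)
    qed
    have finW: "finite W" and finK: "finite K"
      using cW cK by (auto intro: card_ge_0_finite)
    have "0 \<in> W"
      using W by (rule ac.subspace_0)
    have "S \<subseteq> f ` (W - {0})"
    proof
      fix u assume "u \<in> S"
      then obtain z where "z \<in> spread_element u" "z \<in> W" "z \<noteq> 0"
        using none by blast
      then show "u \<in> f ` (W - {0})"
        using f_eq[of z u] by auto
    qed
    \<comment> \<open>Seven nonzero vectors of \<open>W\<close> hit all seven parameters in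
      \<open>S\<close>, so they hit no other parameter.\<close>
    moreover have "card (f ` (W - {0})) \<le> card S"
      using card_image_le[of "W - {0}" f] finW cW S(2) \<open>0 \<in> W\<close> by simp
    ultimately have fW: "f ` (W - {0}) = S"
      using card_seteq[of "f ` (W - {0})" S] finW by simp
    have fKW: "f z \<in> M - S" if z: "z \<in> K - W" for z
    proof -
      have "z \<noteq> 0"
        using z \<open>0 \<in> W\<close> by blast
      have "z ^ 64 = z"
        using z K6 by blast
      then have "z ^ 63 * z = 1 * z"
        by (simp flip: power_Suc2)
      then have "z ^ 63 = 1"
        using \<open>z \<noteq> 0\<close> by simp
      then have "f z \<in> M"
        by (simp add: M_def f_def flip: power_mult)
      moreover have "f z \<notin> S"
        using SK spread[of z] z by blast
      ultimately show ?thesis by blast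
    qed
    have "inj_on f (K - W)"
    proof (rule inj_onI, rule ccontr)
      fix z z' assume z: "z \<in> K - W" and z': "z' \<in> K - W" and eq: "f z = f z'" and "z \<noteq> z'"
      \<comment> \<open>\<open>K\<close> consists of just two cosets of \<open>W\<close>, so
        \<open>z' - z\<close> lies in \<open>W\<close>. It also lies in the spread element shared by
        \<open>z\<close> and \<open>z'\<close>, which forces \<open>f z\<close> into
        \<open>S\<close>.\<close>
      have "(+) z ` W = K - W"
      proof (rule card_seteq)
        show "finite (K - W)"
          using finK by blast
        show "(+) z ` W \<subseteq> K - W"
        proof (rule image_subsetI)
          fix w assume "w \<in> W"
          then have "z + w \<in> K"
            using z \<open>W \<subseteq> K\<close> ac.subspace_add[OF K] by blast
          moreover have "z + w \<notin> W"
            using z ac.subspace_diff[OF W _ \<open>w \<in> W\<close>, of "z + w"] by auto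
          ultimately show "z + w \<in> K - W" by blast
        qed
        show "card (K - W) \<le> card ((+) z ` W)"
          using \<open>W \<subseteq> K\<close> finW cW cK by (simp add: card_image card_Diff_subset)
      qed
      then obtain w where "w \<in> W" "z' = z + w"
        using z' by blast
      then have "z' - z \<in> W"
        by simp
      moreover have "z' - z \<in> spread_element (f z)"
        using ac.subspace_diff[OF subspace_twisted_Frobenius[OF pp], of z' 3 "f z" z]
          spread[of z] spread[of z'] eq
        unfolding spread_element_def by (simp only:)
      moreover from this have "f (z' - z) = f z"
        using \<open>z \<noteq> z'\<close> by (intro f_eq) auto
      ultimately have "f z \<in> S"
        using \<open>z \<noteq> z'\<close> fW by (metis DiffI eq_iff_diff_eq_0 image_eqI singletonD)
      with fKW[OF z] show False by blast
    qed
    then have "card (K - W) \<le> card (M - S)"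
      using fKW M by (intro card_inj_on_le[of f]) (auto simp: finM)
    moreover have "card (K - W) = 8" "card (M - S) = 2"
      using \<open>W \<subseteq> K\<close> finW cW cK S M by (simp_all add: card_Diff_subset)
    ultimately show False by simp
  qed
  note W = this
  have "u ^ 9 = 1" if "u \<in> S" for u
    using S(1) that by (auto simp: M_def)
  then show ?thesis
    unfolding q using S(2) by (intro exI[of _ S] conjI ballI allI impI W) (simp_all, blast)
qed

section \<open>Hyperplanes of subspaces and coordinates on the field of order
  \<open>q ^ 6\<close>\<close>

text \<open>Extend a basis of \<open>T\<close> to one of \<open>K\<close> and drop one of the added
  vectors.\<close>

lemma hyperplane_containing_subspace:
  fixes K T :: "('a::field ^ 'n::finite) set"
  assumes K: "vec.subspace K" and T: "vec.subspace T" "T \<subset> K"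
  obtains W where "vec.subspace W" "T \<subseteq> W" "W \<subseteq> K" "vec.dim K = Suc (vec.dim W)"
proof -
  obtain B where B: "B \<subseteq> T" "vec.independent B" "T \<subseteq> vec.span B"
    by (rule vec.basis_exists[of T])
  have "B \<subseteq> K"
    using B(1) T(2) by blast
  then obtain C where C: "B \<subseteq> C" "C \<subseteq> K" "vec.independent C" "K \<subseteq> vec.span C"
    by (rule vec.maximal_independent_subset_extend[OF _ B(2)])
  have "B \<noteq> C"
  proof
    assume "B = C"
    then have "K \<subseteq> T"
      using C(4) B(1) T(1) vec.span_minimal by blast
    with T(2) show False by blast
  qed
  then obtain x where x: "x \<in> C" "x \<notin> B"
    using C(1) by blast
  have finC: "finite C"
    using C(3) by (rule vec.finiteI_independent)
  show ?thesis
  proof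
    show "vec.subspace (vec.span (C - {x}))"
      by (rule vec.subspace_span)
    show "T \<subseteq> vec.span (C - {x})"
      using B(3) C(1) x vec.span_mono[of B "C - {x}"] by blast
    show "vec.span (C - {x}) \<subseteq> K"
      using C(2) K by (intro vec.span_minimal) auto
    have "vec.independent (C - {x})"
      using C(3) by (rule vec.independent_mono) blast
    then have "vec.dim (vec.span (C - {x})) = card (C - {x})"
      by (simp add: vec.dim_eq_card_independent)
    moreover have "vec.dim K = card C"
      using vec.basis_card_eq_dim[OF C(2,4,3)] by simp
    ultimately show "vec.dim K = Suc (vec.dim (vec.span (C - {x})))"
      by (simp only: card_Suc_Diff1[OF finC x(1)])
  qed
qed

text \<open>The field of order \<open>q ^ 6\<close>, as the fixed points of a Frobenius power, has
  dimension 6 over \<open>'a\<close>; a basis indexed by the type \<open>6\<close> yields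
  \<open>\<phi>\<close>.\<close>

lemma ex_coordinates:
  assumes pp: "primepow CARD('a::{field,finite})"
  shows "\<exists>\<phi> :: 'a ^ 6 \<Rightarrow> 'a alg_closure. (\<forall>v w. \<phi> (v + w) = \<phi> v + \<phi> w) \<and>
    (\<forall>c v. \<phi> (c *s v) = to_ac c * \<phi> v) \<and> inj \<phi> \<and> range \<phi> = {x. x ^ (CARD('a) ^ 6) = x}"
proof -
  \<comment> \<open>The factor 1 presents the field as the twisted Frobenius kernel with
    \<open>u = 1\<close>.\<close>
  define F :: "'a alg_closure set" where "F = {x. x ^ (CARD('a) ^ 6) = 1 * x}"
  have F: "ac.subspace F" "card F = CARD('a) ^ 6"
    using subspace_twisted_Frobenius[OF pp, of 6 1] card_twisted_Frobenius[where u="1 :: 'a alg_closure" and n=6]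
    by (simp_all only: F_def one_neq_zero not_False_eq_True zero_less_numeral)
  obtain B where B: "B \<subseteq> F" "ac.independent B" "F \<subseteq> ac.span B"
    by (rule ac.basis_exists[of F])
  have span: "ac.span B = F"
    by (rule ac.span_subspace[OF B(1,3) F(1)])
  have "finite F"
    using F(2) by (intro card_ge_0_finite) simp
  then have finB: "finite B"
    using B(1) finite_subset by blast
  from card_span_independent[OF ac.vector_space_axioms this B(2)]
  have "CARD('a) ^ card B = CARD('a) ^ 6"
    by (simp only: span F(2))
  then have "card B = CARD(6)"
    using CARD_field_ge_2[where ?'a='a] by (simp add: power_inject_exp)
  then obtain h :: "6 \<Rightarrow> 'a alg_closure" where h: "bij_betw h UNIV B"
    using finite_same_card_bij[of "UNIV :: 6 set" B] finB by auto
  define \<phi> :: "'a ^ 6 \<Rightarrow> 'a alg_closure" where "\<phi> v = (\<Sum>i\<in>UNIV. to_ac (v $ i) * h i)" for v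
  have im: "range \<phi> = F"
  proof -
    have "(\<Sum>b\<in>B. to_ac (u b) * b) = \<phi> (\<chi> i. u (h i))" for u
      by (simp add: \<phi>_def sum.reindex_bij_betw[OF h, symmetric])
    then have "F \<subseteq> range \<phi>"
      unfolding span[symmetric] ac.span_finite[OF finB] by auto
    moreover have "\<phi> v \<in> F" for v
      unfolding \<phi>_def using h B(1)
      by (intro ac.subspace_sum[OF F(1)] ac.subspace_scale[OF F(1)]) (auto simp: bij_betw_def)
    ultimately show ?thesis by blast
  qed
  have "CARD('a ^ 6) = CARD('a) ^ 6"
    by (simp add: card_subspace[OF vec.subspace_UNIV] vec.dim_UNIV)
  then have "card (range \<phi>) = CARD('a ^ 6)"
    unfolding im F(2) by (rule sym)
  then have "inj \<phi>"
    by (rule eq_card_imp_inj_on[OF finite])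
  show ?thesis
  proof (intro exI[of _ \<phi>] conjI allI)
    show "\<phi> (v + w) = \<phi> v + \<phi> w" for v w
      by (simp only: \<phi>_def vector_add_component to_ac_add distrib_right sum.distrib)
    show "\<phi> (c *s v) = to_ac c * \<phi> v" for c v
      by (simp only: \<phi>_def vector_smult_component to_ac_mult sum_distrib_left mult.assoc)
    show "inj \<phi>" by fact
    show "range \<phi> = {x. x ^ (CARD('a) ^ 6) = x}"
      using im by (simp add: F_def)
  qed
qed

lemma spread_elements:
  assumes pp: "primepow CARD('a::{field,finite})"
  shows "\<exists>S :: 'a alg_closure set. card S = 7 \<and> (\<forall>u\<in>S. u ^ (CARD('a) ^ 3 + 1) = 1) \<and>
    (\<forall>W K. ac.subspace W \<longrightarrow> ac.subspace K \<longrightarrow> W \<subseteq> K \<longrightarrow> K \<subseteq> {x. x ^ (CARD('a) ^ 6) = x} \<longrightarrow>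
       card W = CARD('a) ^ 3 \<longrightarrow> card K = CARD('a) ^ 4 \<longrightarrow> (\<forall>u\<in>S. spread_element u \<inter> K \<subseteq> W) \<longrightarrow>
       (\<exists>u\<in>S. spread_element u \<inter> W \<subseteq> {0}))"
proof (cases "CARD('a) = 2")
  case True
  from spread_elements_binary[OF pp this] show ?thesis .
next
  case False
  then have "CARD('a) \<ge> 3"
    using CARD_field_ge_2[where ?'a='a] by linarith
  from spread_elements_geometric[OF pp this] obtain S :: "'a alg_closure set"
    where S: "card S = 7" "\<forall>u\<in>S. u ^ (CARD('a) ^ 3 + 1) = 1"
      "\<forall>W. ac.subspace W \<longrightarrow> card W = CARD('a) ^ 3 \<longrightarrow> (\<exists>u\<in>S. spread_element u \<inter> W \<subseteq> {0})"
    by (elim exE conjE)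
  then show ?thesis
    by (intro exI[of _ S] conjI) simp_all
qed

section \<open>From spread elements to planes of \<open>PG(5, q)\<close>\<close>

theorem theorem5p6:
  fixes q :: nat
  assumes "primepow q" and "CARD('a::{field, finite}) = q"
  shows "\<exists>K :: ('a ^ 6) set set. card K = 7 \<and> higgledy_piggledy 2 K"
proof -
  have pp: "primepow CARD('a)"
    using assms by simp
  have q2: "CARD('a) \<ge> 2"
    by (rule CARD_field_ge_2)
  obtain S :: "'a alg_closure set" where S: "card S = 7" "\<forall>u\<in>S. u ^ (CARD('a) ^ 3 + 1) = 1"
    and transversal: "\<forall>W K. ac.subspace W \<longrightarrow> ac.subspace K \<longrightarrow> W \<subseteq> K \<longrightarrow> K \<subseteq> {x. x ^ (CARD('a) ^ 6) = x} \<longrightarrow>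
       card W = CARD('a) ^ 3 \<longrightarrow> card K = CARD('a) ^ 4 \<longrightarrow> (\<forall>u\<in>S. spread_element u \<inter> K \<subseteq> W) \<longrightarrow>
       (\<exists>u\<in>S. spread_element u \<inter> W \<subseteq> {0})"
    using spread_elements[OF pp] by (elim exE conjE)
  have S2: "u ^ (CARD('a) ^ 3 + 1) = 1" if "u \<in> S" for u
    using S(2) that by (rule bspec)
  obtain \<phi> :: "'a ^ 6 \<Rightarrow> 'a alg_closure"
    where \<phi>_add: "\<And>v w. \<phi> (v + w) = \<phi> v + \<phi> w" and \<phi>_scale: "\<And>c v. \<phi> (c *s v) = to_ac c * \<phi> v"
      and inj: "inj \<phi>" and range: "range \<phi> = {x. x ^ (CARD('a) ^ 6) = x}"
    using ex_coordinates[OF pp] by (elim exE conjE) blast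
  have \<phi>_0: "\<phi> 0 = 0"
    using \<phi>_scale[of 0 0] by simp
  have \<phi>_subspace: "ac.subspace (\<phi> ` W)" if "vec.subspace W" for W
  proof (rule ac.subspaceI)
    show "0 \<in> \<phi> ` W"
      using imageI[OF vec.subspace_0[OF that], of \<phi>] by (simp only: \<phi>_0)
  qed (auto simp flip: \<phi>_add \<phi>_scale intro: vec.subspace_add[OF that] vec.subspace_scale[OF that])
  have \<phi>_card: "card (\<phi> ` W) = CARD('a) ^ vec.dim W" if "vec.subspace W" for W
    using card_subspace[OF that] card_image[OF inj_on_subset[OF inj subset_UNIV], of W] by simp
  define U where "U u = {v. \<phi> v \<in> spread_element u}" for u
  have U_subspace: "vec.subspace (U u)" for u
  proof (rule vec.subspaceI)
    note sub = subspace_twisted_Frobenius[OF pp, of 3 u, folded spread_element_def]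
    show "0 \<in> U u"
      using ac.subspace_0[OF sub] by (simp add: U_def \<phi>_0)
    show "v + w \<in> U u" if "v \<in> U u" "w \<in> U u" for v w
      using that ac.subspace_add[OF sub] by (simp add: U_def \<phi>_add)
    show "c *s v \<in> U u" if "v \<in> U u" for c v
      using that ac.subspace_scale[OF sub] by (simp add: U_def \<phi>_scale)
  qed
  have dim_U: "vec.dim (U u) = 3" if "u \<in> S" for u
  proof -
    have u0: "u \<noteq> 0"
      using S2[OF that] by auto
    \<comment> \<open>Two applications of the power \<open>q ^ 3\<close> multiply \<open>x\<close>
      by \<open>u ^ (q ^ 3 + 1) = 1\<close>, so no element is lost when pulling back along
      \<open>\<phi>\<close>.\<close>
    have "spread_element u \<subseteq> range \<phi>"
    proof
      fix x assume "x \<in> spread_element u"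
      then have x: "x ^ (CARD('a) ^ 3) = u * x"
        by (simp add: spread_element_def)
      have "CARD('a) ^ 6 = CARD('a) ^ 3 * CARD('a) ^ 3"
        by (simp flip: power_add)
      then have "x ^ (CARD('a) ^ 6) = u ^ (CARD('a) ^ 3) * (u * x)"
        by (simp only: power_mult x power_mult_distrib)
      also have "\<dots> = u ^ (CARD('a) ^ 3 + 1) * x"
        by simp
      also have "\<dots> = x"
        by (simp only: S2[OF that] mult_1)
      finally show "x \<in> range \<phi>"
        by (simp only: range mem_Collect_eq)
    qed
    then have "\<phi> ` U u = spread_element u"
      unfolding U_def by auto
    then have "CARD('a) ^ vec.dim (U u) = CARD('a) ^ 3"
      using \<phi>_card[OF U_subspace, of u] card_twisted_Frobenius[OF u0, of 3]
      by (simp add: spread_element_def)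
    then show ?thesis
      using q2 by (simp add: power_inject_exp)
  qed
  have "inj_on U S"
  proof (rule inj_onI)
    fix u u' assume u: "u \<in> S" "u' \<in> S" "U u = U u'"
    \<comment> \<open>A single nonzero vector determines its parameter \<open>u\<close>.\<close>
    obtain v where "v \<in> U u" "v \<noteq> 0"
    proof -
      have "\<not> U u \<subseteq> {0}"
        using dim_U[OF u(1)] vec.dim_subset[of "U u" "{0}"] by auto
      then show ?thesis
        using that by blast
    qed
    moreover from this have "v \<in> U u'" "\<phi> v \<noteq> 0"
      using u(3) inj \<phi>_0 by (auto dest: injD[of \<phi> v 0])
    ultimately show "u = u'"
      by (simp add: U_def spread_element_def)
  qed
  then have card_K: "card (U ` S) = 7"
    by (simp add: card_image S(1))
  have U_proj: "U ` S \<subseteq> proj_subspaces 2"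
    by (auto simp: proj_subspaces_def U_subspace dim_U)
  have span: "proj_span ((\<Union>V\<in>U ` S. points_in V) \<inter> points_in K) = K" (is "?T = K")
    if K: "vec.subspace K" "vec.dim K = 4" for K
  proof (rule ccontr)
    assume "?T \<noteq> K"
    moreover have "?T \<subseteq> K"
      unfolding proj_span_def using K(1) by (intro vec.span_minimal) (auto simp: points_in_def)
    moreover have T: "vec.subspace ?T"
      unfolding proj_span_def by (rule vec.subspace_span)
    ultimately obtain W where W: "vec.subspace W" "?T \<subseteq> W" "W \<subseteq> K" "vec.dim K = Suc (vec.dim W)"
      using hyperplane_containing_subspace[OF K(1) T] by blast
    \<comment> \<open>A nonzero \<open>v\<close> spans a point that is counted in \<open>?T\<close>,
      and \<open>?T\<close> lies in \<open>W\<close>.\<close>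
    have UW: "v \<in> W" if "u \<in> S" "v \<in> U u" "v \<in> K" for u v
    proof (cases "v = 0")
      case True
      then show ?thesis
        using vec.subspace_0[OF W(1)] by simp
    next
      case False
      have sub: "vec.span {v} \<subseteq> V" if "vec.subspace V" "v \<in> V" for V
        using that by (intro vec.span_minimal) auto
      have "vec.span {v} \<in> proj_points"
        using False by (simp add: proj_subspaces_def vec.dim_eq_card_independent)
      then have "vec.span {v} \<in> (\<Union>V\<in>U ` S. points_in V) \<inter> points_in K"
        using sub[OF U_subspace] sub[OF K(1)] that by (auto simp: points_in_def)
      then have "v \<in> ?T"
        unfolding proj_span_def by (intro vec.span_base UnionI[of "vec.span {v}"]) (auto intro: vec.span_base)
      then show ?thesis
        using W(2) by blast
    qed
    have "\<exists>u\<in>S. spread_element u \<inter> \<phi> ` W \<subseteq> {0}"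
    proof (rule transversal[rule_format, of "\<phi> ` W" "\<phi> ` K"])
      show "ac.subspace (\<phi> ` W)" "ac.subspace (\<phi> ` K)"
        using W(1) K(1) by (simp_all only: \<phi>_subspace)
      show "\<phi> ` W \<subseteq> \<phi> ` K"
        using W(3) by (rule image_mono)
      show "\<phi> ` K \<subseteq> {x. x ^ (CARD('a) ^ 6) = x}"
        unfolding range[symmetric] by blast
      show "card (\<phi> ` W) = CARD('a) ^ 3" "card (\<phi> ` K) = CARD('a) ^ 4"
        using K W(4) by (simp_all add: \<phi>_card W(1))
      show "spread_element u \<inter> \<phi> ` K \<subseteq> \<phi> ` W" if "u \<in> S" for u
        using UW[OF that] by (auto simp: U_def)
    qed
    then obtain u where u: "u \<in> S" "spread_element u \<inter> \<phi> ` W \<subseteq> {0}"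
      by blast
    have "U u \<inter> K \<subseteq> {0}"
    proof
      fix v assume "v \<in> U u \<inter> K"
      then have "\<phi> v \<in> spread_element u \<inter> \<phi> ` W"
        using UW[OF u(1), of v] by (auto simp: U_def)
      then have "\<phi> v = \<phi> 0"
        using u(2) \<phi>_0 by auto
      then show "v \<in> {0}"
        using injD[OF inj] by blast
    qed
    \<comment> \<open>A plane and a solid cannot be disjoint here: the linear dimensions 3 and 4 add
      up to more than 6.\<close>
    then have "vec.dim (U u \<inter> K) = 0"
      using vec.dim_subset[of "U u \<inter> K" "{0}"] by simp
    moreover have "vec.dim {x + y |x y. x \<in> U u \<and> y \<in> K} \<le> 6"
      using vec.dim_subset_UNIV[of "{x + y |x y. x \<in> U u \<and> y \<in> K}"] by (simp add: card_cart_basis vec.dimension_def)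
    ultimately show False
      using vec.dim_sums_Int[OF U_subspace K(1), of u] dim_U[OF u(1)] K(2) by linarith
  qed
  have "strong_blocking_set 2 (\<Union>V\<in>U ` S. points_in V)"
    unfolding strong_blocking_set_def
  proof (intro conjI ballI)
    show "(\<Union>V\<in>U ` S. points_in V) \<subseteq> proj_points"
      by (auto simp: points_in_def)
    \<comment> \<open>The projective dimension \<open>6 - 1 - 2 = 3\<close> means linear dimension
      4.\<close>
    fix K :: "('a ^ 6) set" assume "K \<in> proj_subspaces (CARD(6) - 1 - 2)"
    then show "proj_span ((\<Union>V\<in>U ` S. points_in V) \<inter> points_in K) = K"
      by (intro span) (simp_all add: proj_subspaces_def)
  qed simp
  with card_K U_proj show ?thesis
    unfolding higgledy_piggledy_def by blast
qed

end
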